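(* Let $i\in\{1,2\}$ and define $$w_I^i:=-p\vee\sup_{v>0}\Big\{u^i(v)\,\mathbb P(\mathcal V\le v)-p\big(1-\mathbb P(\mathcal V\le v)\big)\Big\}.$$ Then $w_I^i\le u_I^i$. Moreover, when either $p<+\infty$ or there exists $v\in(0,+\infty)$ with $\mathbb P(\mathcal V>v)=0$, one has $w_I^i=u_I^i$.
   Context: Standing assumptions. $u>0$; $D>0$, $r_I,r_J\ge 0$, $\delta\in\mathbb R$, $x^+=\max(x,0)$. $\mu$ is a non-constant real random variable bounded from below by a finite constant $\underline\mu$, with $\mathbb E[e^{\lambda\mu}]<\infty$ for all $\lambda\in\mathbb R$. $\varphi,\psi:\mathbb R_+\to\mathbb R_+$ are $C^1$, increasing, strictly concave, $\varphi'(0)=\psi'(0)=+\infty$, $\varphi'(\infty)=\psi'(\infty)=0$, $\varphi(\infty)+\delta^+\psi(\infty)<\underline\mu$, and $(\varphi')^{-1}(x)\sim(\psi')^{-1}(x)$ as $x\to0$. $g:\mathbb R_+\to\mathbb R$ is $C^1$, increasing, strictly concave, $g'(0)=\infty$, $g'(\infty)=0$, and $\inf\{m>0:g(m)>0\}<\infty$. $b^a,b^m,b^e:\mathbb R_+\to\mathbb R_+$ are $C^1$, increasing, concave; $(b^a)'(0)>0$ (possibly infinite), $(b^a)'(\infty)=0$, $b^a(\infty)<\infty$; $(b^m)'(0)=(b^e)'(0)=\infty$, $(b^m)'(\infty)=(b^e)'(\infty)=0$. $f:\mathbb R_+\to\mathbb R$ is differentiable, increasing, strictly convex, $f'(\infty)=\infty$.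 $F(a)=b^a(a)-f((1+r_I)(D+a))$, and it is assumed that $F'(0)>0$ (possibly infinite). Conventions: $(\phi')^{-1}(+\infty)=0$ for $\phi=\varphi,\psi,g$; $x/0=+\infty$ for $x>0$; $(+\infty)\cdot0=0$; $x\vee y=\max(x,y)$. Incomplete information. Firm $I$ perceives firm $J$'s risk aversion as a $(0,+\infty)$-valued random variable $\mathcal V$ with known distribution, independent of $\mu$; $p\in\mathbb R\cup\{+\infty\}$ is the penalty firm $I$ gets if firm $J$ does not accept the contract. Firm $J$'s best responses are $e^*(\beta)=(\varphi')^{-1}\big(\frac1{(1-\beta)^+}\big)$, $m^*(\gamma)=(g')^{-1}(1/\gamma)$ and, in Situation 1, $a^*(\beta)=(\psi')^{-1}\big(\frac{1+r_J}{(\delta(1-\beta))^+}\big)$. The controls of firm $I$ are $c^1=(\alpha,\beta,\gamma)\in\mathbb R_+\times\mathbb R\times\mathbb R_+$ in Situation 1 and $c^2=(a,\alpha,\beta,\gamma)\in\mathbb R_+\times\mathbb R_+\times\mathbb R\times\mathbb R_+$ in Situation 2. Set, abbreviating $e^*=e^*(\beta)$, $a^*=a^*(\beta)$, $m^*=m^*(\gamma)$, $$\tilde I^1(c^1)=b^a(a^* )-\mathbb E\Big[e^{-u\left(b^m(m^* )-\gamma g(m^* )+b^e(e^* )+\beta\varphi(e^* )-\alpha-\beta(\mu-\delta\psi(a^* ))\right)}\Big],$$ $$\tilde I^2(c^2)=F(a)-\mathbb E\Big[e^{-u\left(b^m(m^* )-\gamma g(m^* )+b^e(e^* )+\beta\varphi(e^*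 )-\alpha-\beta(\mu-\delta\psi(a))\right)}\Big],$$ $$\tilde J^1(v,c^1)=-e^{v(1+r_J)(D+a^* )}\,\mathbb E\Big[e^{-v\left(\alpha+(\beta-1)(\mu-\delta\psi(a^* )-\varphi(e^* ))-e^*+\gamma g(m^* )-m^*\right)}\Big],$$ $$\tilde J^2(v,c^2)=-\mathbb E\Big[e^{-v\left(\alpha+(\beta-1)(\mu-\delta\psi(a)-\varphi(e^* ))-e^*+\gamma g(m^* )-m^*\right)}\Big].$$ The event that firm $J$ accepts the contract is $\mathcal A^i(c^i)=\{-\tilde J^i(\mathcal V,c^i)\le1\}$ (the function $\tilde J^i(\cdot,c^i)$ evaluated at $\mathcal V$). The value of firm $I$'s problem with incomplete information is $$u_I^i=-p\vee\sup_{c^i}\Big\{\tilde I^i(c^i)\,\mathbb P(\mathcal A^i(c^i))-p\big(1-\mathbb P(\mathcal A^i(c^i))\big)\Big\},$$ and the value with complete information that firm $J$'s risk aversion equals $v>0$ is $u^i(v)=\sup\{\tilde I^i(c^i):\ -\tilde J^i(v,c^i)\le1\}$, the suprema being over the control sets above. *)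

theory Defs
  imports "HOL-Probability.Probability" "HOL-Library.Landau_Symbols"
begin

definition strictly_convex_on :: "real set \<Rightarrow> (real \<Rightarrow> real) \<Rightarrow> bool" where
  "strictly_convex_on S h \<longleftrightarrow> convex S \<and>
     (\<forall>x\<in>S. \<forall>y\<in>S. \<forall>t. x \<noteq> y \<longrightarrow> 0 < t \<longrightarrow> t < 1 \<longrightarrow>
        h ((1 - t) * x + t * y) < (1 - t) * h x + t * h y)"

definition strictly_concave_on :: "real set \<Rightarrow> (real \<Rightarrow> real) \<Rightarrow> bool" where
  "strictly_concave_on S h \<longleftrightarrow> strictly_convex_on S (\<lambda>x. - h x)"

text \<open>
  Functions on the half-line \<open>{0..}\<close> are total functions on the reals whose values at
  negative arguments are never used.  Their derivative at 0 is one-sided and may be infinite,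
  so derivatives are limits of difference quotients in the extended reals.
\<close>

definition has_ederiv :: "(real \<Rightarrow> real) \<Rightarrow> real \<Rightarrow> ereal \<Rightarrow> bool" where
  "has_ederiv h x L \<longleftrightarrow>
     ((\<lambda>y. ereal ((h y - h x) / (y - x))) \<longlongrightarrow> L) (at x within {0..})"

definition ederiv :: "(real \<Rightarrow> real) \<Rightarrow> real \<Rightarrow> ereal" where
  "ederiv h x = Lim (at x within {0..}) (\<lambda>y. ereal ((h y - h x) / (y - x)))"

text \<open>Only the derivative at 0 may be infinite; continuity of \<open>h\<close> at 0 does not then follow
  from the existence of the derivative and is required separately.\<close>

definition C1_half_line :: "(real \<Rightarrow> real) \<Rightarrow> bool" where
  "C1_half_line h \<longleftrightarrow>
     continuous_on {0..} h \<and>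
     (\<forall>x>0. h differentiable (at x)) \<and>
     (\<exists>L. has_ederiv h 0 L) \<and>
     continuous_on {0..} (ederiv h)"

definition at_infinity_value :: "(real \<Rightarrow> real) \<Rightarrow> ereal" where
  "at_infinity_value h = Lim at_top (\<lambda>x. ereal (h x))"

text \<open>When \<open>ederiv h 0 = \<infinity>\<close> and \<open>h\<close> is differentiable on \<open>{0<..}\<close>, 0 is the only point
  of \<open>{0..}\<close> with infinite derivative, so \<open>inv_ederiv h \<infinity> = 0\<close>.\<close>

definition inv_ederiv :: "(real \<Rightarrow> real) \<Rightarrow> ereal \<Rightarrow> real" where
  "inv_ederiv h = inv_into {0..} (ederiv h)"

locale contracting = prob_space M
  for M :: "'w measure" +
  fixes \<mu> :: "'w \<Rightarrow> real" and \<mu>low :: real and V :: "'w \<Rightarrow> real"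
    and u D r\<^sub>I r\<^sub>J \<delta> :: real
    and \<phi> \<psi> g ba bm be f :: "real \<Rightarrow> real"
    and p :: ereal
  assumes u_pos: "0 < u"
    and D_pos: "0 < D"
    and r\<^sub>I_nonneg: "0 \<le> r\<^sub>I"
    and r\<^sub>J_nonneg: "0 \<le> r\<^sub>J"

    and \<mu>_rv: "random_variable borel \<mu>"
    and \<mu>_nonconst: "\<not> (\<exists>c. AE \<omega> in M. \<mu> \<omega> = c)"
    and \<mu>_bounded_below: "AE \<omega> in M. \<mu>low \<le> \<mu> \<omega>"
    and \<mu>_exp_moments: "\<And>s. integrable M (\<lambda>\<omega>. exp (s * \<mu> \<omega>))"

    and \<phi>_nonneg: "\<And>x. 0 \<le> x \<Longrightarrow> 0 \<le> \<phi> x"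
    and \<phi>_C1: "C1_half_line \<phi>"
    and \<phi>_mono: "mono_on {0..} \<phi>"
    and \<phi>_concave: "strictly_concave_on {0..} \<phi>"
    and \<phi>_deriv_0: "ederiv \<phi> 0 = \<infinity>"
    and \<phi>_deriv_inf: "(ederiv \<phi> \<longlongrightarrow> 0) at_top"
    and \<psi>_nonneg: "\<And>x. 0 \<le> x \<Longrightarrow> 0 \<le> \<psi> x"
    and \<psi>_C1: "C1_half_line \<psi>"
    and \<psi>_mono: "mono_on {0..} \<psi>"
    and \<psi>_concave: "strictly_concave_on {0..} \<psi>"
    and \<psi>_deriv_0: "ederiv \<psi> 0 = \<infinity>"
    and \<psi>_deriv_inf: "(ederiv \<psi> \<longlongrightarrow> 0) at_top"
    and \<phi>_\<psi>_bound:
      "at_infinity_value \<phi> + ereal (max \<delta> 0) * at_infinity_value \<psi> < ereal \<mu>low"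
    and \<phi>_\<psi>_equiv:
      "(\<lambda>x. inv_ederiv \<phi> (ereal x)) \<sim>[at_right 0] (\<lambda>x. inv_ederiv \<psi> (ereal x))"

    and g_C1: "C1_half_line g"
    and g_mono: "mono_on {0..} g"
    and g_concave: "strictly_concave_on {0..} g"
    and g_deriv_0: "ederiv g 0 = \<infinity>"
    and g_deriv_inf: "(ederiv g \<longlongrightarrow> 0) at_top"
    and g_positive: "(INF m\<in>{m. 0 < m \<and> 0 < g m}. ereal m) < \<infinity>"

    and ba_nonneg: "\<And>x. 0 \<le> x \<Longrightarrow> 0 \<le> ba x"
    and ba_C1: "C1_half_line ba"
    and ba_mono: "mono_on {0..} ba"
    and ba_concave: "concave_on {0..} ba"
    and ba_deriv_0: "0 < ederiv ba 0"
    and ba_deriv_inf: "(ederiv ba \<longlongrightarrow> 0) at_top"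
    and ba_bounded: "at_infinity_value ba < \<infinity>"
    and bm_nonneg: "\<And>x. 0 \<le> x \<Longrightarrow> 0 \<le> bm x"
    and bm_C1: "C1_half_line bm"
    and bm_mono: "mono_on {0..} bm"
    and bm_concave: "concave_on {0..} bm"
    and bm_deriv_0: "ederiv bm 0 = \<infinity>"
    and bm_deriv_inf: "(ederiv bm \<longlongrightarrow> 0) at_top"
    and be_nonneg: "\<And>x. 0 \<le> x \<Longrightarrow> 0 \<le> be x"
    and be_C1: "C1_half_line be"
    and be_mono: "mono_on {0..} be"
    and be_concave: "concave_on {0..} be"
    and be_deriv_0: "ederiv be 0 = \<infinity>"
    and be_deriv_inf: "(ederiv be \<longlongrightarrow> 0) at_top"

    and f_diff: "f differentiable_on {0..}"
    and f_mono: "mono_on {0..} f"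
    and f_convex: "strictly_convex_on {0..} f"
    and f_deriv_inf: "(ederiv f \<longlongrightarrow> \<infinity>) at_top"
    and F_deriv_0: "0 < ederiv (\<lambda>a. ba a - f ((1 + r\<^sub>I) * (D + a))) 0"

    and V_rv: "random_variable borel V"
    and V_pos: "\<And>\<omega>. \<omega> \<in> space M \<Longrightarrow> 0 < V \<omega>"
    and V_indep: "indep_var borel V borel \<mu>"
    and p_not_minf: "p \<noteq> - \<infinity>"
begin

definition F :: "real \<Rightarrow> real" where
  "F a = ba a - f ((1 + r\<^sub>I) * (D + a))"

text \<open>Division is in \<^typ>\<open>ereal\<close>, where \<open>x / 0 = \<infinity>\<close> for \<open>x > 0\<close>.\<close>

definition e_star :: "real \<Rightarrow> real" where
  "e_star \<beta> = inv_ederiv \<phi> (1 / ereal (max (1 - \<beta>) 0))"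

definition m_star :: "real \<Rightarrow> real" where
  "m_star \<gamma> = inv_ederiv g (1 / ereal \<gamma>)"

definition a_star :: "real \<Rightarrow> real" where
  "a_star \<beta> = inv_ederiv \<psi> (ereal (1 + r\<^sub>J) / ereal (max (\<delta> * (1 - \<beta>)) 0))"

definition controls1 :: "(real \<times> real \<times> real) set" where
  "controls1 = {0..} \<times> UNIV \<times> {0..}"

definition controls2 :: "(real \<times> real \<times> real \<times> real) set" where
  "controls2 = {0..} \<times> {0..} \<times> UNIV \<times> {0..}"

definition I1 :: "real \<times> real \<times> real \<Rightarrow> real" where
  "I1 = (\<lambda>(\<alpha>, \<beta>, \<gamma>). let e = e_star \<beta>; a = a_star \<beta>; m = m_star \<gamma> in
     ba a - expectation (\<lambda>\<omega>. exp (- u *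
       (bm m - \<gamma> * g m + be e + \<beta> * \<phi> e - \<alpha> - \<beta> * (\<mu> \<omega> - \<delta> * \<psi> a)))))"

definition I2 :: "real \<times> real \<times> real \<times> real \<Rightarrow> real" where
  "I2 = (\<lambda>(a, \<alpha>, \<beta>, \<gamma>). let e = e_star \<beta>; m = m_star \<gamma> in
     F a - expectation (\<lambda>\<omega>. exp (- u *
       (bm m - \<gamma> * g m + be e + \<beta> * \<phi> e - \<alpha> - \<beta> * (\<mu> \<omega> - \<delta> * \<psi> a)))))"

definition J1 :: "real \<Rightarrow> real \<times> real \<times> real \<Rightarrow> real" where
  "J1 v = (\<lambda>(\<alpha>, \<beta>, \<gamma>). let e = e_star \<beta>; a = a_star \<beta>; m = m_star \<gamma> in
     - exp (v * (1 + r\<^sub>J) * (D + a)) * expectation (\<lambda>\<omega>. exp (- v *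
       (\<alpha> + (\<beta> - 1) * (\<mu> \<omega> - \<delta> * \<psi> a - \<phi> e) - e + \<gamma> * g m - m))))"

definition J2 :: "real \<Rightarrow> real \<times> real \<times> real \<times> real \<Rightarrow> real" where
  "J2 v = (\<lambda>(a, \<alpha>, \<beta>, \<gamma>). let e = e_star \<beta>; m = m_star \<gamma> in
     - expectation (\<lambda>\<omega>. exp (- v *
       (\<alpha> + (\<beta> - 1) * (\<mu> \<omega> - \<delta> * \<psi> a - \<phi> e) - e + \<gamma> * g m - m))))"

text \<open>
  The following are generic in the type of controls, which differs between the two situations.
  Values are extended reals, with \<open>\<infinity> * 0 = 0\<close> and the supremum of the empty set being
  \<open>- \<infinity>\<close>.
\<close>

definition prob_accept :: "(real \<Rightarrow> 'c \<Rightarrow> real) \<Rightarrow> 'c \<Rightarrow> real" where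
  "prob_accept J c = prob {\<omega> \<in> space M. - J (V \<omega>) c \<le> 1}"

definition incomplete_value :: "'c set \<Rightarrow> ('c \<Rightarrow> real) \<Rightarrow> (real \<Rightarrow> 'c \<Rightarrow> real) \<Rightarrow> ereal" where
  "incomplete_value C I J = max (- p)
     (SUP c\<in>C. ereal (I c) * ereal (prob_accept J c) - p * ereal (1 - prob_accept J c))"

definition complete_value :: "'c set \<Rightarrow> ('c \<Rightarrow> real) \<Rightarrow> (real \<Rightarrow> 'c \<Rightarrow> real) \<Rightarrow> real \<Rightarrow> ereal" where
  "complete_value C I J v = (SUP c\<in>{c \<in> C. - J v c \<le> 1}. ereal (I c))"

definition u_complete :: "nat \<Rightarrow> real \<Rightarrow> ereal" where
  "u_complete i v =
     (if i = 1 then complete_value controls1 I1 J1 v else complete_value controls2 I2 J2 v)"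

definition u_incomplete :: "nat \<Rightarrow> ereal" where
  "u_incomplete i =
     (if i = 1 then incomplete_value controls1 I1 J1 else incomplete_value controls2 I2 J2)"

definition w_incomplete :: "nat \<Rightarrow> ereal" where
  "w_incomplete i = max (- p)
     (SUP v\<in>{0<..}. u_complete i v * ereal (\<P>(\<omega> in M. V \<omega> \<le> v))
        - p * ereal (1 - \<P>(\<omega> in M. V \<omega> \<le> v)))"

end

end

theory Submission
  imports Defs
begin

text \<open>
  For a fixed contract \<open>c\<close>, \<open>- J v c\<close> is the moment generating function at \<open>v\<close> of an affine
  function of \<open>\<mu>\<close>: it is convex in \<open>v\<close> and equals 1 at 0.  The risk aversions that accept \<open>c\<close>
  therefore form an interval that is closed on the right and starts at 0.  If it is \<open>(0, v]\<close>,
  then firm \<open>I\<close> gets from \<open>c\<close> at most what it gets from an optimal contract for the known risk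
  aversion \<open>v\<close>; if it is all of \<open>(0, \<infinity>)\<close>, one lets \<open>v\<close> tend to \<open>\<infinity>\<close>.
\<close>

section \<open>Sublevel sets of convex functions and limits of monotone functions\<close>

lemma convex_sublevel_cases:
  fixes h :: "real \<Rightarrow> real"
  assumes conv: "convex_on UNIV h" and h0: "h 0 = 1"
  obtains (none) "\<And>v. 0 < v \<Longrightarrow> 1 < h v"
    | (upto) s where "0 < s" "\<And>v. 0 < v \<Longrightarrow> h v \<le> 1 \<longleftrightarrow> v \<le> s"
    | (all) "\<And>v. 0 < v \<Longrightarrow> h v \<le> 1"
proof -
  define S where "S = {v. 0 < v \<and> h v \<le> 1}"
  have down: "h w \<le> 1" if "v \<in> S" "0 < w" "w \<le> v" for v w
  proof -
    have v: "0 < v" "h v \<le> 1" using that(1) by (auto simp: S_def)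
    define t where "t = w / v"
    have t: "0 \<le> t" "t \<le> 1" "w = (1 - t) * 0 + t * v"
      using v that by (auto simp: t_def)
    have "h w \<le> (1 - t) * h 0 + t * h v"
      using convex_onD[OF conv t(1,2), of 0 v] t(3) by simp
    also have "\<dots> \<le> (1 - t) * 1 + t * 1"
      using t v h0 by (intro add_mono mult_left_mono) auto
    finally show ?thesis by simp
  qed
  show thesis
  proof (cases "S = {}")
    case True
    then show thesis by (intro none) (force simp: S_def not_le)
  next
    case False
    then obtain v0 where v0: "v0 \<in> S" by blast
    show thesis
    proof (cases "bdd_above S")
      case True
      \<comment> \<open>A convex function on an open set is continuous, so the sublevel set is
        closed and the cutoff \<open>Sup S\<close> belongs to it.\<close>
      have "continuous_on UNIV h"
        using convex_on_continuous[OF _ conv] by simp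
      then have "closed {v. h v \<le> 1}"
        by (intro closed_Collect_le) auto
      then have "Sup S \<in> {v. h v \<le> 1}"
        using True False by (intro closed_subset_contains_Sup) (auto simp: S_def)
      moreover have "v0 \<le> Sup S" using v0 True by (rule cSup_upper)
      ultimately have s: "Sup S \<in> S" using v0 by (auto simp: S_def)
      show thesis
      proof (rule upto[of "Sup S"])
        show "0 < Sup S" using s by (simp add: S_def)
        show "h v \<le> 1 \<longleftrightarrow> v \<le> Sup S" if "0 < v" for v
          using down[OF s that] cSup_upper[OF _ True, of v] that by (auto simp: S_def)
      qed
    next
      case unbounded: False
      show thesis
      proof (rule all)
        fix v :: real assume "0 < v"
        obtain v' where "v' \<in> S" "v \<le> v'"
          using unbounded unfolding bdd_above_def by (meson linear)
        then show "h v \<le> 1" using down \<open>0 < v\<close> by blast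
      qed
    qed
  qed
qed

text \<open>\<open>Lim\<close> is informative only if the limit exists. A monotone function does
  converge in \<open>ereal\<close>, to its supremum over the half-line.\<close>

lemma mono_on_le_at_infinity_value:
  assumes mono: "mono_on {0..} h" and x: "0 \<le> x"
  shows "ereal (h x) \<le> at_infinity_value h"
proof -
  define L where "L = (SUP y\<in>{0..}. ereal (h y))"
  have up: "ereal (h y) \<le> L" if "0 \<le> y" for y
    using that unfolding L_def by (intro SUP_upper) auto
  have "((\<lambda>y. ereal (h y)) \<longlongrightarrow> L) at_top"
  proof (rule increasing_tendsto)
    show "\<forall>\<^sub>F y in at_top. ereal (h y) \<le> L"
      using eventually_ge_at_top[of 0] by eventually_elim (rule up)
    fix l assume "l < L"
    then obtain z where z: "0 \<le> z" "l < ereal (h z)"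
      unfolding L_def less_SUP_iff by auto
    show "\<forall>\<^sub>F y in at_top. l < ereal (h y)"
      using eventually_ge_at_top[of z]
    proof eventually_elim
      case (elim y)
      then have "h z \<le> h y" using z by (intro mono_onD[OF mono]) auto
      then show ?case using z(2) by (metis ereal_less_eq(3) order_less_le_trans)
    qed
  qed
  then have "at_infinity_value h = L"
    unfolding at_infinity_value_def by (intro tendsto_Lim) auto
  then show ?thesis using up[OF x] by simp
qed

section \<open>Acceptance as a bound on exponential moments of \<mu>\<close>

context contracting
begin

text \<open>Convexity of \<open>exp\<close> is integrated pointwise; exponential moments of every
  order make all the integrals involved finite.\<close>

lemma convex_exp_moment_affine:
  "convex_on UNIV (\<lambda>v. expectation (\<lambda>\<omega>. exp (v * (k + l * \<mu> \<omega>))))"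
proof (rule convex_onI)
  have int: "integrable M (\<lambda>\<omega>. exp (v * (k + l * \<mu> \<omega>)))" for v
  proof -
    have "integrable M (\<lambda>\<omega>. exp (v * k) * exp ((v * l) * \<mu> \<omega>))"
      by (intro integrable_mult_right \<mu>_exp_moments)
    then show ?thesis by (simp add: exp_add[symmetric] algebra_simps)
  qed
  fix t x y :: real assume t: "0 < t" "t < 1"
  have "expectation (\<lambda>\<omega>. exp (((1 - t) *\<^sub>R x + t *\<^sub>R y) * (k + l * \<mu> \<omega>)))
    \<le> expectation (\<lambda>\<omega>. (1 - t) * exp (x * (k + l * \<mu> \<omega>)) + t * exp (y * (k + l * \<mu> \<omega>)))"
  proof (rule integral_mono)
    fix \<omega>
    show "exp (((1 - t) *\<^sub>R x + t *\<^sub>R y) * (k + l * \<mu> \<omega>))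
      \<le> (1 - t) * exp (x * (k + l * \<mu> \<omega>)) + t * exp (y * (k + l * \<mu> \<omega>))"
      using convex_onD[OF exp_convex, of t "x * (k + l * \<mu> \<omega>)" "y * (k + l * \<mu> \<omega>)"] t
      by (simp add: algebra_simps)
  qed (intro int Bochner_Integration.integrable_add integrable_mult_right)+
  also have "\<dots> = (1 - t) * expectation (\<lambda>\<omega>. exp (x * (k + l * \<mu> \<omega>)))
      + t * expectation (\<lambda>\<omega>. exp (y * (k + l * \<mu> \<omega>)))"
    by (simp add: int)
  finally show "expectation (\<lambda>\<omega>. exp (((1 - t) *\<^sub>R x + t *\<^sub>R y) * (k + l * \<mu> \<omega>)))
    \<le> (1 - t) * expectation (\<lambda>\<omega>. exp (x * (k + l * \<mu> \<omega>)))
      + t * expectation (\<lambda>\<omega>. exp (y * (k + l * \<mu> \<omega>)))" .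
qed simp

text \<open>The responses to a fixed contract do not depend on \<open>v\<close>, so the exponent is
  \<open>v\<close> times an affine function of \<mu> with slope 1 - \<beta>. The deterministic debt
  factor goes into the constant \<open>k\<close>.\<close>

lemma neg_J1_eq_exp_moment:
  obtains k l where "\<And>v. - J1 v c = expectation (\<lambda>\<omega>. exp (v * (k + l * \<mu> \<omega>)))"
proof -
  obtain \<alpha> \<beta> \<gamma> where c: "c = (\<alpha>, \<beta>, \<gamma>)" by (cases c)
  define e a m where "e = e_star \<beta>" and "a = a_star \<beta>" and "m = m_star \<gamma>"
  define k where "k = (1 + r\<^sub>J) * (D + a) - (\<alpha> - (\<beta> - 1) * (\<delta> * \<psi> a + \<phi> e) - e + \<gamma> * g m - m)"
  have "- J1 v c = expectation (\<lambda>\<omega>. exp (v * (k + (1 - \<beta>) * \<mu> \<omega>)))" for v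
    unfolding c J1_def Let_def prod.case e_def[symmetric] a_def[symmetric] m_def[symmetric]
    by (simp add: k_def exp_add[symmetric] algebra_simps
        flip: Bochner_Integration.integral_mult_right_zero)
  then show thesis by (rule that)
qed

lemma neg_J2_eq_exp_moment:
  obtains k l where "\<And>v. - J2 v c = expectation (\<lambda>\<omega>. exp (v * (k + l * \<mu> \<omega>)))"
proof -
  obtain a \<alpha> \<beta> \<gamma> where c: "c = (a, \<alpha>, \<beta>, \<gamma>)" by (cases c)
  define e m where "e = e_star \<beta>" and "m = m_star \<gamma>"
  define k where "k = - (\<alpha> - (\<beta> - 1) * (\<delta> * \<psi> a + \<phi> e) - e + \<gamma> * g m - m)"
  have "- J2 v c = expectation (\<lambda>\<omega>. exp (v * (k + (1 - \<beta>) * \<mu> \<omega>)))" for v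
    unfolding c J2_def Let_def prod.case e_def[symmetric] m_def[symmetric]
    by (simp add: k_def algebra_simps)
  then show thesis by (rule that)
qed

lemma ba_bounded_above:
  obtains B where "\<And>x. 0 \<le> x \<Longrightarrow> ba x \<le> B"
proof (cases "at_infinity_value ba")
  case (real B)
  show thesis
    using mono_on_le_at_infinity_value[OF ba_mono] real by (intro that[of B]) auto
next
  case PInf
  then show thesis using ba_bounded by simp
next
  case MInf
  then show thesis using mono_on_le_at_infinity_value[OF ba_mono, of 0] by simp
qed

text \<open>For finite \<open>p\<close> the payoff is \<open>- p + (x + p) * q\<close>: it grows
  with \<open>q\<close> if \<open>- p \<le> x\<close> and is otherwise at most \<open>- p\<close>.
  For infinite \<open>p\<close> it is -infinity unless \<open>q = 1\<close>, which forces
  \<open>r = 1\<close>.\<close>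

lemma ereal_payoff_mono:
  assumes "0 \<le> q" "q \<le> r" "r \<le> 1"
  shows "ereal x * ereal q - p * ereal (1 - q) \<le> max (- p) (ereal x * ereal r - p * ereal (1 - r))"
proof (cases p)
  case (real p')
  show ?thesis
  proof (cases "- p' \<le> x")
    case True
    then have "(x + p') * q \<le> (x + p') * r"
      using assms by (intro mult_left_mono) auto
    then show ?thesis by (simp add: real le_max_iff_disj algebra_simps)
  next
    case False
    then have "(x + p') * q \<le> 0"
      using assms by (simp add: mult_nonpos_nonneg)
    then show ?thesis by (simp add: real le_max_iff_disj algebra_simps)
  qed
next
  case PInf
  then show ?thesis using assms by (cases "q = 1") auto
next
  case MInf
  then show ?thesis using p_not_minf by simp
qed

lemma prob_V_le_tendsto: "((\<lambda>v. \<P>(\<omega> in M. V \<omega> \<le> v)) \<longlongrightarrow> 1) at_top"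
proof -
  interpret V: real_distribution "distr M borel V"
    using V_rv by (rule real_distribution_distr)
  have "cdf (distr M borel V) = (\<lambda>v. \<P>(\<omega> in M. V \<omega> \<le> v))"
    using V_rv by (auto simp: fun_eq_iff cdf_def measure_distr intro!: arg_cong[where f = prob])
  then show ?thesis using V.cdf_lim_at_top_prob by simp
qed

section \<open>Comparison of the two values for an arbitrary control set\<close>

context
  fixes C :: "'c set" and I :: "'c \<Rightarrow> real" and J :: "real \<Rightarrow> 'c \<Rightarrow> real"
  assumes moment: "\<And>c. \<exists>k l. \<forall>v. - J v c = expectation (\<lambda>\<omega>. exp (v * (k + l * \<mu> \<omega>)))"
begin

lemma convex_neg_J: "convex_on UNIV (\<lambda>v. - J v c)"
proof -
  obtain k l where "\<And>v. - J v c = expectation (\<lambda>\<omega>. exp (v * (k + l * \<mu> \<omega>)))"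
    using moment[of c] by blast
  then show ?thesis using convex_exp_moment_affine by simp
qed

lemma neg_J_0: "- J 0 c = 1"
proof -
  obtain k l where "\<And>v. - J v c = expectation (\<lambda>\<omega>. exp (v * (k + l * \<mu> \<omega>)))"
    using moment[of c] by blast
  from this[of 0] show ?thesis by (simp add: prob_space)
qed

text \<open>\<open>V\<close> is positive at every point of \<open>space M\<close>, so the trichotomy
  carries over to the event of acceptance: it is empty, \<open>V \<le> s\<close>, or the whole
  space.\<close>

lemma acceptance_cases:
  obtains (none) "prob_accept J c = 0" "\<And>v. 0 < v \<Longrightarrow> 1 < - J v c"
    | (upto) s where "0 < s" "- J s c \<le> 1" "prob_accept J c = \<P>(\<omega> in M. V \<omega> \<le> s)"
        "\<And>v. 0 < v \<Longrightarrow> - J v c \<le> 1 \<Longrightarrow> v \<le> s"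
    | (all) "prob_accept J c = 1" "\<And>v. 0 < v \<Longrightarrow> - J v c \<le> 1"
  using convex_neg_J[of c] neg_J_0[of c]
proof (cases rule: convex_sublevel_cases)
  case none
  then have "{\<omega> \<in> space M. - J (V \<omega>) c \<le> 1} = {}"
    using V_pos by (auto simp flip: not_less)
  then show thesis using that(1) none by (simp only: prob_accept_def measure_empty)
next
  case (upto s)
  then have "{\<omega> \<in> space M. - J (V \<omega>) c \<le> 1} = {\<omega> \<in> space M. V \<omega> \<le> s}"
    using V_pos by auto
  then show thesis using that(2)[of s] upto by (simp add: prob_accept_def)
next
  case all
  then have "{\<omega> \<in> space M. - J (V \<omega>) c \<le> 1} = space M"
    using V_pos by auto
  then show thesis using that(3) all by (simp add: prob_accept_def prob_space)
qed

lemma prob_accept_le_1: "prob_accept J c \<le> 1"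
  by (simp add: prob_accept_def)

text \<open>A contract that suits \<open>v\<close> suits every smaller positive risk
  aversion.\<close>

lemma prob_V_le_accept:
  assumes "0 < v" "- J v c \<le> 1"
  shows "\<P>(\<omega> in M. V \<omega> \<le> v) \<le> prob_accept J c"
proof (cases rule: acceptance_cases[of c])
  case none
  then show ?thesis using assms by force
next
  case (upto s)
  then have "v \<le> s" using assms by blast
  then show ?thesis
    unfolding upto(3) using V_rv by (intro finite_measure_mono) auto
qed simp

lemma incomplete_value_ge:
  assumes "c \<in> C"
  shows "ereal (I c) * ereal (prob_accept J c) - p * ereal (1 - prob_accept J c)
    \<le> incomplete_value C I J"
  unfolding incomplete_value_def using assms by (intro max.coboundedI2 SUP_upper)

text \<open>The bound on \<open>I\<close> excludes the junk value \<open>\<infinity> - \<infinity> = \<infinity>\<close>.\<close>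
lemma complete_payoff_le_incomplete_value:
  assumes bound: "\<And>c. c \<in> C \<Longrightarrow> I c \<le> B" and v: "0 < v"
  shows "complete_value C I J v * ereal (\<P>(\<omega> in M. V \<omega> \<le> v)) - p * ereal (1 - \<P>(\<omega> in M. V \<omega> \<le> v))
    \<le> incomplete_value C I J"
proof -
  define q where "q = \<P>(\<omega> in M. V \<omega> \<le> v)"
  define U where "U = complete_value C I J v"
  define R where "R = incomplete_value C I J"
  have q: "0 \<le> q" "q \<le> 1" by (auto simp: q_def)
  have pR: "- p \<le> R" by (simp add: R_def incomplete_value_def)
  have U: "U \<le> ereal B"
    unfolding U_def complete_value_def using bound by (intro SUP_least) auto
  have U_least: "U \<le> z" if "\<And>c. c \<in> C \<Longrightarrow> - J v c \<le> 1 \<Longrightarrow> ereal (I c) \<le> z" for z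
    unfolding U_def complete_value_def using that by (intro SUP_least) auto
  \<comment> \<open>The true acceptance probability of \<open>c\<close> is at least
    \<open>q\<close>; where a higher probability would hurt, the payoff is below \<open>- p\<close>
    anyway.\<close>
  have R: "ereal (I c) * ereal q - p * ereal (1 - q) \<le> R" if c: "c \<in> C" "- J v c \<le> 1" for c
  proof -
    have "ereal (I c) * ereal q - p * ereal (1 - q)
      \<le> max (- p) (ereal (I c) * ereal (prob_accept J c) - p * ereal (1 - prob_accept J c))"
      using q(1) prob_V_le_accept[OF v c(2)] prob_accept_le_1
      unfolding q_def by (rule ereal_payoff_mono)
    also have "\<dots> \<le> R"
      using pR incomplete_value_ge[OF c(1)] by (simp add: R_def)
    finally show ?thesis .
  qed
  have "U * ereal q - p * ereal (1 - q) \<le> R"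
  proof (cases "q = 1")
    case True
    then show ?thesis using U_least[of R] R by (simp flip: one_ereal_def zero_ereal_def)
  next
    case q1: False
    show ?thesis
    proof (cases p)
      case (real p')
      show ?thesis
      proof (cases U)
        case U: (real U')
        show ?thesis
        proof (cases R)
          case (real R')
          show ?thesis
          proof (cases "q = 0")
            case True
            then show ?thesis using pR \<open>p = ereal p'\<close> by (simp add: U real)
          next
            case False
            \<comment> \<open>Solving the inequality \<open>R\<close> for \<open>I c\<close> gives a
              bound uniform in \<open>c\<close>, which passes to the supremum
              \<open>U\<close>.\<close>
            then have "U \<le> ereal ((R' + p' * (1 - q)) / q)"
              using R q by (intro U_least) (auto simp: real \<open>p = ereal p'\<close> field_simps)
            then show ?thesis
              using False q by (simp add: U real \<open>p = ereal p'\<close> field_simps)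
          qed
        qed (use pR \<open>p = ereal p'\<close> in auto)
      next
        case PInf
        then show ?thesis using \<open>U \<le> ereal B\<close> by simp
      next
        \<comment> \<open>As \<open>I\<close> is real-valued, this means that no contract is
          feasible at \<open>v\<close>. If \<open>q = 0\<close>, the product \<open>U * q\<close> is
          0 and \<open>- p\<close> remains.\<close>
        case MInf
        show ?thesis
        proof (cases "q = 0")
          case True
          then show ?thesis using pR by (simp add: real flip: one_ereal_def zero_ereal_def)
        next
          case False
          then show ?thesis using q by (simp add: MInf real)
        qed
      qed
    next
      case PInf
      \<comment> \<open>The penalty is infinite since \<open>q < 1\<close>, so the payoff is
        -infinity as soon as \<open>U * q\<close> is not infinity.\<close>
      have "U * ereal q < \<infinity>"
        using U q by (cases U) auto
      then show ?thesis
        using q q1 by (cases "U * ereal q") (auto simp: PInf)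
    next
      case MInf
      then show ?thesis using p_not_minf by simp
    qed
  qed
  then show ?thesis by (simp add: U_def q_def R_def)
qed

lemma complete_payoff_ge:
  assumes "c \<in> C" "- J v c \<le> 1" "0 \<le> q"
  shows "ereal (I c) * ereal q - p * ereal (1 - q)
    \<le> complete_value C I J v * ereal q - p * ereal (1 - q)"
proof -
  have "ereal (I c) \<le> complete_value C I J v"
    unfolding complete_value_def using assms by (intro SUP_upper) auto
  then show ?thesis
    using assms(3) by (intro ereal_minus_mono ereal_mult_right_mono order_refl) auto
qed

text \<open>\<open>fin\<close> serves the contracts that every risk aversion accepts. The
  probability of \<open>V \<le> v\<close> may only approach 1, and an infinite \<open>p\<close>
  would punish any shortfall infinitely.\<close>

lemma incomplete_payoff_le:
  assumes fin: "p < \<infinity> \<or> (\<exists>v>0. \<P>(\<omega> in M. V \<omega> > v) = 0)" and c: "c \<in> C"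
    and pW: "- p \<le> W"
    and W: "\<And>v. 0 < v \<Longrightarrow> complete_value C I J v * ereal (\<P>(\<omega> in M. V \<omega> \<le> v))
        - p * ereal (1 - \<P>(\<omega> in M. V \<omega> \<le> v)) \<le> W"
  shows "ereal (I c) * ereal (prob_accept J c) - p * ereal (1 - prob_accept J c) \<le> W"
proof (cases rule: acceptance_cases[of c])
  case none
  then show ?thesis using pW by (simp flip: one_ereal_def zero_ereal_def)
next
  case (upto s)
  \<comment> \<open>The competitor is the known risk aversion \<open>s\<close>: the contract is
    feasible for it and is accepted exactly when \<open>V \<le> s\<close>.\<close>
  then show ?thesis
    using complete_payoff_ge[OF c upto(2)] W[OF upto(1)] by (metis measure_nonneg order_trans)
next
  case all
  have le: "ereal (I c) * ereal (\<P>(\<omega> in M. V \<omega> \<le> v)) - p * ereal (1 - \<P>(\<omega> in M. V \<omega> \<le> v)) \<le> W"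
    if "0 < v" for v
    using complete_payoff_ge[OF c all(2)[OF that] measure_nonneg] W[OF that] by (rule order_trans)
  have "ereal (I c) \<le> W"
  proof (cases "p < \<infinity>")
    case True
    then obtain p' where p': "p = ereal p'" using p_not_minf by (cases p) auto
    \<comment> \<open>As \<open>v\<close> grows, the finite penalty for the shortfall vanishes and
      \<open>I c\<close> is left.\<close>
    have "((\<lambda>v. ereal (I c * \<P>(\<omega> in M. V \<omega> \<le> v) - p' * (1 - \<P>(\<omega> in M. V \<omega> \<le> v))))
        \<longlongrightarrow> ereal (I c * 1 - p' * (1 - 1))) at_top"
      by (intro tendsto_intros prob_V_le_tendsto)
    moreover have "\<forall>\<^sub>F v in at_top.
        ereal (I c * \<P>(\<omega> in M. V \<omega> \<le> v) - p' * (1 - \<P>(\<omega> in M. V \<omega> \<le> v))) \<le> W"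
      using eventually_gt_at_top[of 0] by eventually_elim (use le in \<open>simp add: p'\<close>)
    ultimately have "ereal (I c * 1 - p' * (1 - 1)) \<le> W"
      by (rule tendsto_upperbound) simp
    then show ?thesis by simp
  next
    case False
    then obtain v where v: "0 < v" "\<P>(\<omega> in M. V \<omega> > v) = 0" using fin by blast
    \<comment> \<open>Here \<open>p\<close> is infinite, but \<open>p * 0 = 0\<close>, so at this
      \<open>v\<close> the payoff of \<open>c\<close> is \<open>I c\<close>.\<close>
    have "\<P>(\<omega> in M. V \<omega> \<le> v) = 1"
      using prob_neg[of "\<lambda>\<omega>. v < V \<omega>"] V_rv v(2) by (simp add: not_less)
    then show ?thesis using le[OF v(1)] by (simp flip: one_ereal_def zero_ereal_def)
  qed
  then show ?thesis using all(1) by (simp flip: one_ereal_def zero_ereal_def)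
qed

lemma incomplete_value_characterization:
  assumes bound: "\<And>c. c \<in> C \<Longrightarrow> I c \<le> B"
    and W: "W = max (- p) (SUP v\<in>{0<..}. complete_value C I J v * ereal (\<P>(\<omega> in M. V \<omega> \<le> v))
        - p * ereal (1 - \<P>(\<omega> in M. V \<omega> \<le> v)))"
  shows "W \<le> incomplete_value C I J \<and>
    (p < \<infinity> \<or> (\<exists>v>0. \<P>(\<omega> in M. V \<omega> > v) = 0) \<longrightarrow> W = incomplete_value C I J)"
proof (intro conjI impI)
  show le: "W \<le> incomplete_value C I J"
    unfolding W
  proof (rule max.boundedI)
    show "- p \<le> incomplete_value C I J" by (simp add: incomplete_value_def)
    show "(SUP v\<in>{0<..}. complete_value C I J v * ereal (\<P>(\<omega> in M. V \<omega> \<le> v))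
        - p * ereal (1 - \<P>(\<omega> in M. V \<omega> \<le> v))) \<le> incomplete_value C I J"
      by (rule SUP_least, rule complete_payoff_le_incomplete_value[OF bound]) simp_all
  qed
  assume fin: "p < \<infinity> \<or> (\<exists>v>0. \<P>(\<omega> in M. V \<omega> > v) = 0)"
  have pW: "- p \<le> W" unfolding W by (rule max.cobounded1)
  have vW: "complete_value C I J v * ereal (\<P>(\<omega> in M. V \<omega> \<le> v))
      - p * ereal (1 - \<P>(\<omega> in M. V \<omega> \<le> v)) \<le> W" if "0 < v" for v
    unfolding W using that by (intro max.coboundedI2 SUP_upper) simp
  have "incomplete_value C I J \<le> W"
    unfolding incomplete_value_def
    by (rule max.boundedI[OF pW], rule SUP_least, rule incomplete_payoff_le[OF fin _ pW vW])
  with le show "W = incomplete_value C I J" by (rule antisym)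
qed

end

section \<open>Upper bounds on the payoff of firm \<open>I\<close>\<close>

text \<open>Outside the range of the derivative, \<open>inv_ederiv\<close> is a junk value of unknown sign.\<close>
lemma a_star_nonneg: "0 \<le> a_star \<beta>"
proof -
  define z where "z = ereal (1 + r\<^sub>J) / ereal (max (\<delta> * (1 - \<beta>)) 0)"
  have "0 < z"
    using r\<^sub>J_nonneg by (cases "max (\<delta> * (1 - \<beta>)) 0 = 0") (auto simp: z_def)
  then have "\<forall>\<^sub>F x in at_top. 0 \<le> x \<and> ederiv \<psi> x < z"
    using \<psi>_deriv_inf by (intro eventually_conj eventually_ge_at_top order_tendstoD)
  then obtain b where b: "0 \<le> b" "ederiv \<psi> b < z"
    using eventually_happens'[OF trivial_limit_at_top_linorder] by blast
  have "continuous_on {0..b} (ederiv \<psi>)"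
    using \<psi>_C1 unfolding C1_half_line_def by (auto elim: continuous_on_subset)
  \<comment> \<open>The derivative runs continuously in \<open>ereal\<close> from infinity at 0 to
    below \<open>z\<close> at \<open>b\<close>, so it attains \<open>z\<close>, which may itself be
    infinity.\<close>
  then obtain x where "0 \<le> x" "ederiv \<psi> x = z"
    using IVT2'[of "ederiv \<psi>" b z 0] b less_imp_le[OF b(2)] \<psi>_deriv_0 by auto
  then have "z \<in> ederiv \<psi> ` {0..}" by auto
  then have "inv_ederiv \<psi> z \<in> {0..}"
    unfolding inv_ederiv_def by (rule inv_into_into)
  then show ?thesis by (simp add: a_star_def z_def)
qed

lemma expectation_exp_nonneg: "0 \<le> expectation (\<lambda>\<omega>. exp (X \<omega> :: real))"
  by (rule Bochner_Integration.integral_nonneg) simp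

text \<open>A nonnegative expectation is subtracted from \<open>ba\<close> at
  \<open>a_star \<beta>\<close>, a nonnegative argument for every \<beta>; hence a bound on all
  triples.\<close>

lemma I1_bounded_above:
  obtains B where "\<And>c. I1 c \<le> B"
proof -
  obtain B where B: "\<And>x. 0 \<le> x \<Longrightarrow> ba x \<le> B" by (rule ba_bounded_above) blast
  have "I1 c \<le> B" for c
    using B[OF a_star_nonneg[of "fst (snd c)"]]
    by (auto simp: I1_def Let_def split_beta intro!: diff_le_eq[THEN iffD2]
        add_increasing2 expectation_exp_nonneg)
  then show thesis by (rule that)
qed

text \<open>\<open>controls2\<close> supplies \<open>0 \<le> a\<close>. As \<open>f\<close>
  increases, the debt term costs at least its value at \<open>a = 0\<close>, while \<open>ba\<close>
  is bounded.\<close>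

lemma I2_bounded_above:
  obtains B where "\<And>c. c \<in> controls2 \<Longrightarrow> I2 c \<le> B"
proof -
  obtain B where B: "\<And>x. 0 \<le> x \<Longrightarrow> ba x \<le> B" by (rule ba_bounded_above) blast
  have "F a \<le> B - f ((1 + r\<^sub>I) * D)" if "0 \<le> a" for a
  proof -
    have "f ((1 + r\<^sub>I) * D) \<le> f ((1 + r\<^sub>I) * (D + a))"
      using that D_pos r\<^sub>I_nonneg by (intro mono_onD[OF f_mono]) auto
    then show ?thesis using B[OF that] by (simp add: F_def)
  qed
  then have "I2 c \<le> B - f ((1 + r\<^sub>I) * D)" if "c \<in> controls2" for c
    using that
    by (auto simp: I2_def Let_def controls2_def intro!: diff_le_eq[THEN iffD2]
        add_increasing2 expectation_exp_nonneg)
  then show thesis by (rule that)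
qed

lemma w_incomplete_characterization:
  assumes "i \<in> {1, 2}"
  shows "w_incomplete i \<le> u_incomplete i \<and>
    (p < \<infinity> \<or> (\<exists>v>0. \<P>(\<omega> in M. V \<omega> > v) = 0) \<longrightarrow> w_incomplete i = u_incomplete i)"
proof (cases "i = 1")
  case True
  obtain B where B: "\<And>c. I1 c \<le> B" by (rule I1_bounded_above) blast
  have "\<exists>k l. \<forall>v. - J1 v c = expectation (\<lambda>\<omega>. exp (v * (k + l * \<mu> \<omega>)))" for c
    by (rule neg_J1_eq_exp_moment[of c]) blast
  \<comment> \<open>Stated between functions, the equation can be used under the supremum in
    \<open>w_incomplete\<close>.\<close>
  moreover have "u_complete i = complete_value controls1 I1 J1"
    using True by (simp add: fun_eq_iff u_complete_def)
  ultimately have "w_incomplete i \<le> incomplete_value controls1 I1 J1 \<and>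
    (p < \<infinity> \<or> (\<exists>v>0. \<P>(\<omega> in M. V \<omega> > v) = 0) \<longrightarrow>
      w_incomplete i = incomplete_value controls1 I1 J1)"
    by (intro incomplete_value_characterization[where B = B] B) (simp_all only: w_incomplete_def)
  then show ?thesis
    unfolding u_incomplete_def if_P[OF True] .
next
  case False
  obtain B where B: "\<And>c. c \<in> controls2 \<Longrightarrow> I2 c \<le> B" by (rule I2_bounded_above) blast
  have "\<exists>k l. \<forall>v. - J2 v c = expectation (\<lambda>\<omega>. exp (v * (k + l * \<mu> \<omega>)))" for c
    by (rule neg_J2_eq_exp_moment[of c]) blast
  moreover have "u_complete i = complete_value controls2 I2 J2"
    using False by (simp add: fun_eq_iff u_complete_def)
  ultimately have "w_incomplete i \<le> incomplete_value controls2 I2 J2 \<and>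
    (p < \<infinity> \<or> (\<exists>v>0. \<P>(\<omega> in M. V \<omega> > v) = 0) \<longrightarrow>
      w_incomplete i = incomplete_value controls2 I2 J2)"
    by (intro incomplete_value_characterization[where B = B] B) (simp_all only: w_incomplete_def)
  then show ?thesis
    unfolding u_incomplete_def if_not_P[OF False] .
qed

end

theorem theorem7:
  fixes M :: "'w measure" and \<mu> V :: "'w \<Rightarrow> real"
    and \<mu>low u D r\<^sub>I r\<^sub>J \<delta> :: real
    and \<phi> \<psi> g ba bm be f :: "real \<Rightarrow> real"
    and p :: ereal and i :: nat
  assumes "contracting M \<mu> \<mu>low V u D r\<^sub>I r\<^sub>J \<delta> \<phi> \<psi> g ba bm be f p"
    and "i \<in> {1, 2}"
  shows "contracting.w_incomplete M \<mu> V u D r\<^sub>I r\<^sub>J \<delta> \<phi> \<psi> g ba bm be f p i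
           \<le> contracting.u_incomplete M \<mu> V u D r\<^sub>I r\<^sub>J \<delta> \<phi> \<psi> g ba bm be f p i
       \<and> (p < \<infinity> \<or> (\<exists>v>0. \<P>(\<omega> in M. V \<omega> > v) = 0) \<longrightarrow>
         contracting.w_incomplete M \<mu> V u D r\<^sub>I r\<^sub>J \<delta> \<phi> \<psi> g ba bm be f p i
           = contracting.u_incomplete M \<mu> V u D r\<^sub>I r\<^sub>J \<delta> \<phi> \<psi> g ba bm be f p i)"
  using assms by (rule contracting.w_incomplete_characterization)

end
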